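(* Let $X$ be a paracompact space and suppose that $G\leq\mathcal{H}(X)$ is isotopically factorizable and that $G_0$, the identity component of $G$, is non-fixing. Then the commutator group $[\tilde G,\tilde G]$ of the universal covering group $\tilde G$ is perfect, that is, $[[\tilde G,\tilde G],[\tilde G,\tilde G]]=[\tilde G,\tilde G]$.
   Context: Paracompact spaces are understood to be Hausdorff. $\mathcal{H}(X)$ is the group of all homeomorphisms of $X$, endowed with the compact-open topology; $G\le\mathcal{H}(X)$ carries the induced topology and is regarded as a topological group. For $g\in\mathcal{H}(X)$, $\mathrm{supp}(g)$ is the closure of $\{x\in X:g(x)\ne x\}$. $\mathcal{P}G$ is the group, under pointwise multiplication, of all paths (isotopies) $\gamma:[0,1]\to G$ with $\gamma(0)=e$. The universal covering group is $\tilde G=\mathcal{P}G/{\sim}$, where $\sim$ is the relation of homotopy relative to endpoints. $G_0$, called the identity component of $G$, is the subgroup of all $g\in G$ for which there is $f\in\mathcal{P}G$ with $f_1=g$. For $f\in\mathcal{P}G$, $\mathrm{supp}(f)=\bigcup_{t\in[0,1]}\mathrm{supp}(f_t)$. $G$ is isotopically factorizable if for every open cover $\mathcal{U}$ of $X$ and every $f\in\mathcal{P}G$ there are $U_1,\ldots,U_r\in\mathcal{U}$ and $f_1,\ldots,f_r\in\mathcal{P}G$ such that $f=f_1\cdots f_r$ and $\mathrm{supp}(f_i)\subset U_i$ for all $i$. A group $H$ of homeomorphisms of $X$ is non-fixing if for every $x\in X$ the orbit $\{h(x):h\in H\}$ is different from $\{x\}$. $[f,g]=fgf^{-1}g^{-1}$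 and $[H,H]$ denotes the commutator subgroup. *)

theory Defs
  imports "HOL-Analysis.Analysis" "HOL-Algebra.Bij" "HOL-Algebra.Generated_Groups"
begin

definition paracompact_space :: "'a topology \<Rightarrow> bool" where
  "paracompact_space X \<longleftrightarrow>
     Hausdorff_space X \<and>
     (\<forall>\<U>. (\<forall>U\<in>\<U>. openin X U) \<and> \<Union>\<U> = topspace X \<longrightarrow>
        (\<exists>\<V>. (\<forall>V\<in>\<V>. openin X V) \<and> \<Union>\<V> = topspace X \<and>
             (\<forall>V\<in>\<V>. \<exists>U\<in>\<U>. V \<subseteq> U) \<and> locally_finite_in X \<V>))"

text \<open>As in \<^const>\<open>BijGroup\<close>, maps are extensional on \<open>topspace X\<close>, so that equality of
  functions is equality of maps, and multiplication is composition.\<close>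

definition homeo_group :: "'a topology \<Rightarrow> ('a \<Rightarrow> 'a) monoid" where
  "homeo_group X =
     (BijGroup (topspace X))
       \<lparr>carrier := {f \<in> extensional (topspace X). homeomorphic_map X X f}\<rparr>"

text \<open>The generating sets with \<open>K = {}\<close> show that the underlying set is the set of all
  (extensional) continuous maps.\<close>

definition compact_open_topology :: "'a topology \<Rightarrow> 'b topology \<Rightarrow> ('a \<Rightarrow> 'b) topology" where
  "compact_open_topology X Y =
     topology_generated_by
       {{f \<in> extensional (topspace X). continuous_map X Y f \<and> f ` K \<subseteq> U} | K U.
          compactin X K \<and> openin Y U}"

definition topological_group :: "'g topology \<Rightarrow> 'g monoid \<Rightarrow> bool" where
  "topological_group T M \<longleftrightarrow>
     group M \<and> topspace T = carrier M \<and>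
     continuous_map (prod_topology T T) T (\<lambda>(x, y). x \<otimes>\<^bsub>M\<^esub> y) \<and>
     continuous_map T T (\<lambda>x. inv\<^bsub>M\<^esub> x)"

definition path_group :: "'g topology \<Rightarrow> 'g monoid \<Rightarrow> (real \<Rightarrow> 'g) monoid" where
  "path_group T M =
     \<lparr>carrier = {\<gamma> \<in> extensional {0..1}. pathin T \<gamma> \<and> \<gamma> 0 = \<one>\<^bsub>M\<^esub>},
      mult = (\<lambda>\<gamma> \<delta>. \<lambda>t\<in>{0..1}. \<gamma> t \<otimes>\<^bsub>M\<^esub> \<delta> t),
      one = (\<lambda>t\<in>{0..1}. \<one>\<^bsub>M\<^esub>)\<rparr>"

definition path_homotopy_rel :: "'g topology \<Rightarrow> 'g monoid \<Rightarrow> ((real \<Rightarrow> 'g) \<times> (real \<Rightarrow> 'g)) set" where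
  "path_homotopy_rel T M =
     {(\<gamma>, \<delta>). \<gamma> \<in> carrier (path_group T M) \<and> \<delta> \<in> carrier (path_group T M) \<and>
        homotopic_with (\<lambda>h. h 0 = \<gamma> 0 \<and> h 1 = \<gamma> 1) (top_of_set {0..1}) T \<gamma> \<delta>}"

text \<open>For a topological group, the product of two classes is the class of the product of any
  two representatives, so that the union below is a single class.\<close>

definition universal_covering_group :: "'g topology \<Rightarrow> 'g monoid \<Rightarrow> (real \<Rightarrow> 'g) set monoid" where
  "universal_covering_group T M =
     \<lparr>carrier = carrier (path_group T M) // path_homotopy_rel T M,
      mult = (\<lambda>A B. \<Union>\<gamma>\<in>A. \<Union>\<delta>\<in>B. path_homotopy_rel T M `` {\<gamma> \<otimes>\<^bsub>path_group T M\<^esub> \<delta>}),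
      one = path_homotopy_rel T M `` {\<one>\<^bsub>path_group T M\<^esub>}\<rparr>"

definition identity_component :: "'g topology \<Rightarrow> 'g monoid \<Rightarrow> 'g set" where
  "identity_component T M = {g \<in> carrier M. \<exists>f\<in>carrier (path_group T M). f 1 = g}"

abbreviation homeo_subgroup :: "'a topology \<Rightarrow> ('a \<Rightarrow> 'a) set \<Rightarrow> ('a \<Rightarrow> 'a) monoid" where
  "homeo_subgroup X G \<equiv> (homeo_group X)\<lparr>carrier := G\<rparr>"

abbreviation homeo_subgroup_topology :: "'a topology \<Rightarrow> ('a \<Rightarrow> 'a) set \<Rightarrow> ('a \<Rightarrow> 'a) topology" where
  "homeo_subgroup_topology X G \<equiv> subtopology (compact_open_topology X X) G"

definition supp :: "'a topology \<Rightarrow> ('a \<Rightarrow> 'a) \<Rightarrow> 'a set" where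
  "supp X g = X closure_of {x \<in> topspace X. g x \<noteq> x}"

definition path_supp :: "'a topology \<Rightarrow> (real \<Rightarrow> 'a \<Rightarrow> 'a) \<Rightarrow> 'a set" where
  "path_supp X f = (\<Union>t\<in>{0..1}. supp X (f t))"

text \<open>The empty list is allowed; it only adds the trivial factorization of the identity, which
  for nonempty \<open>X\<close> also factors through any member of the cover.\<close>

definition isotopically_factorizable :: "'a topology \<Rightarrow> ('a \<Rightarrow> 'a) set \<Rightarrow> bool" where
  "isotopically_factorizable X G \<longleftrightarrow>
     (let P = path_group (homeo_subgroup_topology X G) (homeo_subgroup X G) in
      \<forall>\<U>. (\<forall>U\<in>\<U>. openin X U) \<and> \<Union>\<U> = topspace X \<longrightarrow>
        (\<forall>f\<in>carrier P. \<exists>fs. set fs \<subseteq> carrier P \<and>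
           (\<forall>g\<in>set fs. \<exists>U\<in>\<U>. path_supp X g \<subseteq> U) \<and>
           f = foldr (\<otimes>\<^bsub>P\<^esub>) fs \<one>\<^bsub>P\<^esub>))"

definition non_fixing :: "'a topology \<Rightarrow> ('a \<Rightarrow> 'a) set \<Rightarrow> bool" where
  "non_fixing X H \<longleftrightarrow> (\<forall>x\<in>topspace X. {h x | h. h \<in> H} \<noteq> {x})"

end

theory Submission
  imports Defs
begin

text \<open>
  In the universal covering group, conjugating the class of a path \<open>\<gamma>\<close> by the class of a path
  \<open>\<eta>\<close> is the same as conjugating \<open>\<gamma>\<close> pointwise by the single homeomorphism \<open>\<eta> 1\<close>; the homotopy
  is \<open>(s, t) \<mapsto> \<eta> (max s t) (\<gamma> t) (\<eta> (max s t))\<^sup>-\<^sup>1\<close>. Hence the support moves by \<open>\<eta> 1\<close>.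

  Orbits of the identity component are path connected, so a nontrivial orbit is infinite, and every
  point has a neighbourhood \<open>V\<close> for which \<open>V\<close>, \<open>\<eta> 1 ` V\<close>, \<open>\<theta> 1 ` V\<close> are pairwise disjoint for
  some paths \<open>\<eta>\<close>, \<open>\<theta>\<close>. If \<open>a\<close>, \<open>b\<close> are supported in \<open>V\<close>, then \<open>[a, b] = [[a, \<eta>], [b, \<theta>]]\<close> lies in
  the second derived subgroup \<open>N\<close>. To treat arbitrary \<open>f\<close> and \<open>g\<close>, factorize \<open>g\<close> into pieces, each
  fixing the complement of a closed \<open>K\<close> inside an open displaced \<open>W\<close> (paracompact spaces are
  regular), and for each piece factorize \<open>f\<close> along the cover \<open>{W, X - K}\<close>: a factor of \<open>f\<close> either
  lives in \<open>W\<close> together with that piece or commutes with it. As \<open>N\<close> is normal, \<open>[f, g] \<in> N\<close>.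
\<close>

section \<open>Commutators modulo a normal subgroup\<close>

context group
begin

text \<open>Rests on the identity \<open>[ac, b] = a [c, b] a^-1 [a, b]\<close>; normality absorbs
  the conjugation by \<open>a\<close>. It reduces a commutator with a product to commutators with
  the factors.\<close>

lemma commutator_mult_left_in_normal:
  assumes "N \<lhd> G" and "a \<in> carrier G" "c \<in> carrier G" "b \<in> carrier G"
    and "a \<otimes> b \<otimes> inv a \<otimes> inv b \<in> N" and "c \<otimes> b \<otimes> inv c \<otimes> inv b \<in> N"
  shows "(a \<otimes> c) \<otimes> b \<otimes> inv (a \<otimes> c) \<otimes> inv b \<in> N"
proof -
  interpret N: normal N G by fact
  have cancel: "inv x \<otimes> (x \<otimes> y) = y" if "x \<in> carrier G" "y \<in> carrier G" for x y
    using that by (simp add: m_assoc [symmetric])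
  have "(a \<otimes> c) \<otimes> b \<otimes> inv (a \<otimes> c) \<otimes> inv b
      = (a \<otimes> (c \<otimes> b \<otimes> inv c \<otimes> inv b) \<otimes> inv a) \<otimes> (a \<otimes> b \<otimes> inv a \<otimes> inv b)"
    using assms(2-4) by (simp add: m_assoc inv_mult_group cancel)
  also have "\<dots> \<in> N"
    using assms N.inv_op_closed2 by blast
  finally show ?thesis .
qed

text \<open>Since \<open>[b, a]\<close> is the inverse of \<open>[a, b]\<close>, a product in the
  right entry can be treated by the rule for the left entry.\<close>

lemma commutator_swap_in_normal:
  assumes "N \<lhd> G" and "a \<in> carrier G" "b \<in> carrier G"
    and "a \<otimes> b \<otimes> inv a \<otimes> inv b \<in> N"
  shows "b \<otimes> a \<otimes> inv b \<otimes> inv a \<in> N"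
proof -
  interpret N: normal N G by fact
  have "b \<otimes> a \<otimes> inv b \<otimes> inv a = inv (a \<otimes> b \<otimes> inv a \<otimes> inv b)"
    using assms(2,3) by (simp add: m_assoc inv_mult_group)
  then show ?thesis
    using assms(4) by simp
qed

lemma commutator_eq_one:
  assumes "a \<in> carrier G" "b \<in> carrier G" and "a \<otimes> b = b \<otimes> a"
  shows "a \<otimes> b \<otimes> inv a \<otimes> inv b = \<one>"
  using assms by (metis inv_closed m_assoc m_closed r_inv r_one)

lemma commute_inv:
  assumes "a \<in> carrier G" "b \<in> carrier G" and "a \<otimes> b = b \<otimes> a"
  shows "inv a \<otimes> b = b \<otimes> inv a"
  using assms by (metis inv_closed inv_solve_left inv_solve_right m_assoc m_closed)

lemma commutator_in_derived:
  assumes "a \<in> H" "b \<in> H"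
  shows "a \<otimes> b \<otimes> inv a \<otimes> inv b \<in> derived G H"
  using assms unfolding derived_def by (blast intro: generate.incl)

text \<open>The point is \<open>[a, b] = [[a, p], [b, q]]\<close>. Each inner commutator is
  \<open>a\<close> or \<open>b\<close> times the inverse of its conjugate, and the three commutation
  hypotheses let these extra factors cancel in the outer commutator.\<close>

lemma commutator_in_derived_derived:
  assumes [simp]: "a \<in> carrier G" "b \<in> carrier G" "p \<in> carrier G" "q \<in> carrier G"
  defines "a' \<equiv> p \<otimes> a \<otimes> inv p" and "b' \<equiv> q \<otimes> b \<otimes> inv q"
  assumes "a' \<otimes> b = b \<otimes> a'" and "a \<otimes> b' = b' \<otimes> a" and "a' \<otimes> b' = b' \<otimes> a'"
  shows "a \<otimes> b \<otimes> inv a \<otimes> inv b \<in> derived G (derived G (carrier G))"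
proof -
  \<comment> \<open>Chosen so that \<open>a \<otimes> c = [a, p]\<close> and
    \<open>b \<otimes> d = [b, q]\<close>; \<open>c\<close> commutes with \<open>b\<close> and
    \<open>d\<close>, and \<open>d\<close> commutes with \<open>a\<close>.\<close>
  define c where "c = inv a'"
  define d where "d = inv b'"
  have [simp]: "a' \<in> carrier G" "b' \<in> carrier G" "c \<in> carrier G" "d \<in> carrier G"
    by (simp_all add: a'_def b'_def c_def d_def)
  have cb: "c \<otimes> b = b \<otimes> c"
    using assms(7) by (simp add: c_def commute_inv)
  have da: "d \<otimes> a = a \<otimes> d"
    using assms(8) by (simp add: d_def commute_inv)
  have cd: "c \<otimes> d = d \<otimes> c"
    using commute_inv[of b' c] commute_inv[of a' b'] assms(9) by (simp add: c_def d_def)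
  have cancel: "x \<otimes> (inv x \<otimes> y) = y" "inv x \<otimes> (x \<otimes> y) = y"
    if "x \<in> carrier G" "y \<in> carrier G" for x y
    using that by (simp_all add: m_assoc [symmetric])
  have "(a \<otimes> c) \<otimes> (b \<otimes> d) = a \<otimes> (c \<otimes> b) \<otimes> d"
    by (simp add: m_assoc)
  also have "\<dots> = a \<otimes> b \<otimes> (c \<otimes> d)"
    by (simp add: cb m_assoc)
  also have "\<dots> = a \<otimes> b \<otimes> d \<otimes> c"
    by (simp add: cd m_assoc)
  finally have ac_bd: "(a \<otimes> c) \<otimes> (b \<otimes> d) = a \<otimes> b \<otimes> d \<otimes> c" .
  have "inv (a \<otimes> c) \<otimes> inv (b \<otimes> d) = inv c \<otimes> (inv a \<otimes> inv d) \<otimes> inv b"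
    by (simp add: inv_mult_group m_assoc)
  also have "inv a \<otimes> inv d = inv d \<otimes> inv a"
    using da by (metis \<open>d \<in> carrier G\<close> assms(1) inv_mult_group)
  finally have "a \<otimes> b \<otimes> inv a \<otimes> inv b
      = (a \<otimes> c) \<otimes> (b \<otimes> d) \<otimes> (inv (a \<otimes> c) \<otimes> inv (b \<otimes> d))"
    unfolding ac_bd by (simp add: m_assoc cancel)
  then have eq: "a \<otimes> b \<otimes> inv a \<otimes> inv b
      = (a \<otimes> c) \<otimes> (b \<otimes> d) \<otimes> inv (a \<otimes> c) \<otimes> inv (b \<otimes> d)"
    by (simp add: m_assoc)
  have "a \<otimes> c = a \<otimes> p \<otimes> inv a \<otimes> inv p" "b \<otimes> d = b \<otimes> q \<otimes> inv b \<otimes> inv q"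
    by (simp_all add: c_def d_def a'_def b'_def inv_mult_group m_assoc)
  then have "a \<otimes> c \<in> derived G (carrier G)" "b \<otimes> d \<in> derived G (carrier G)"
    by (simp_all add: commutator_in_derived)
  then show ?thesis
    unfolding eq by (rule commutator_in_derived)
qed

end

section \<open>The universal covering group of a topological group\<close>

locale top_group = group M for M :: "'g monoid" (structure) +
  fixes T :: "'g topology"
  assumes topological_group: "topological_group T M"
begin

abbreviation "I \<equiv> top_of_set {0..1::real}"
abbreviation "P \<equiv> path_group T M"
abbreviation "Cov \<equiv> universal_covering_group T M"
abbreviation "R \<equiv> path_homotopy_rel T M"

definition cls :: "(real \<Rightarrow> 'g) \<Rightarrow> (real \<Rightarrow> 'g) set" where
  "cls \<gamma> = R `` {\<gamma>}"

lemma topspace_T [simp]: "topspace T = carrier M"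
  using topological_group by (simp add: topological_group_def)

lemma continuous_map_mult:
  assumes "continuous_map Z T f" "continuous_map Z T g"
  shows "continuous_map Z T (\<lambda>z. f z \<otimes> g z)"
proof -
  have "continuous_map Z T ((\<lambda>(x, y). x \<otimes> y) \<circ> (\<lambda>z. (f z, g z)))"
    using topological_group assms unfolding topological_group_def
    by (intro continuous_map_compose) (auto simp: continuous_map_paired)
  then show ?thesis by (simp add: o_def)
qed

lemma continuous_map_inv:
  assumes "continuous_map Z T f"
  shows "continuous_map Z T (\<lambda>z. inv (f z))"
proof -
  have "continuous_map Z T ((\<lambda>x. inv x) \<circ> f)"
    using topological_group assms unfolding topological_group_def
    by (intro continuous_map_compose) auto
  then show ?thesis by (simp add: o_def)
qed

lemma mem_carrier_path_group:
  "\<gamma> \<in> carrier P \<longleftrightarrow> \<gamma> \<in> extensional {0..1} \<and> continuous_map I T \<gamma> \<and> \<gamma> 0 = \<one>"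
  by (simp add: path_group_def pathin_def)

lemma restrict_in_path_group:
  assumes "continuous_map I T \<gamma>" "\<gamma> 0 = \<one>"
  shows "restrict \<gamma> {0..1} \<in> carrier P"
  using assms continuous_map_eq[of I T \<gamma> "restrict \<gamma> {0..1}"]
  by (auto simp: mem_carrier_path_group)

lemma path_group_closed [simp]:
  "\<gamma> \<in> carrier P \<Longrightarrow> t \<in> {0..1} \<Longrightarrow> \<gamma> t \<in> carrier M"
  unfolding mem_carrier_path_group
  using continuous_map_image_subset_topspace[of I T \<gamma>] by auto

lemma mult_path_group: "\<gamma> \<otimes>\<^bsub>P\<^esub> \<delta> = (\<lambda>t\<in>{0..1}. \<gamma> t \<otimes> \<delta> t)"
  by (simp add: path_group_def)

lemma one_path_group: "\<one>\<^bsub>P\<^esub> = (\<lambda>t\<in>{0..1}. \<one>)"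
  by (simp add: path_group_def)

lemma path_group_eqI:
  assumes "\<gamma> \<in> carrier P" "\<delta> \<in> carrier P" "\<And>t. t \<in> {0..1} \<Longrightarrow> \<gamma> t = \<delta> t"
  shows "\<gamma> = \<delta>"
  using assms unfolding mem_carrier_path_group by (metis extensionalityI)

lemma inv_path_closed:
  assumes "\<gamma> \<in> carrier P"
  shows "(\<lambda>t\<in>{0..1}. inv (\<gamma> t)) \<in> carrier P"
  using assms unfolding mem_carrier_path_group[of \<gamma>]
  by (intro restrict_in_path_group) (auto intro: continuous_map_inv)

lemma mult_path_closed:
  assumes "\<gamma> \<in> carrier P" "\<delta> \<in> carrier P"
  shows "(\<lambda>t\<in>{0..1}. \<gamma> t \<otimes> \<delta> t) \<in> carrier P"
  using assms unfolding mem_carrier_path_group[of \<gamma>] mem_carrier_path_group[of \<delta>]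
  by (intro restrict_in_path_group) (auto intro: continuous_map_mult)

lemma group_path_group: "group P"
proof (rule groupI)
  show "\<one>\<^bsub>P\<^esub> \<in> carrier P"
    unfolding one_path_group by (intro restrict_in_path_group) auto
  then show "\<one>\<^bsub>P\<^esub> \<otimes>\<^bsub>P\<^esub> \<gamma> = \<gamma>" if "\<gamma> \<in> carrier P" for \<gamma>
    using that mult_path_closed[of "\<one>\<^bsub>P\<^esub>" \<gamma>]
    by (intro path_group_eqI) (auto simp: mult_path_group one_path_group)
  show "\<gamma> \<otimes>\<^bsub>P\<^esub> \<delta> \<in> carrier P" if "\<gamma> \<in> carrier P" "\<delta> \<in> carrier P" for \<gamma> \<delta>
    using that by (simp add: mult_path_group mult_path_closed)
  show "\<gamma> \<otimes>\<^bsub>P\<^esub> \<delta> \<otimes>\<^bsub>P\<^esub> \<epsilon> = \<gamma> \<otimes>\<^bsub>P\<^esub> (\<delta> \<otimes>\<^bsub>P\<^esub> \<epsilon>)"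
    if "\<gamma> \<in> carrier P" "\<delta> \<in> carrier P" "\<epsilon> \<in> carrier P" for \<gamma> \<delta> \<epsilon>
    using that by (auto simp: mult_path_group m_assoc intro!: restrict_ext)
  show "\<exists>\<delta>\<in>carrier P. \<delta> \<otimes>\<^bsub>P\<^esub> \<gamma> = \<one>\<^bsub>P\<^esub>" if "\<gamma> \<in> carrier P" for \<gamma>
    using that inv_path_closed[OF that]
    by (intro bexI[of _ "\<lambda>t\<in>{0..1}. inv (\<gamma> t)"])
       (auto simp: mult_path_group one_path_group intro!: restrict_ext)
qed

sublocale P: group P
  by (rule group_path_group)

lemma inv_path_group:
  assumes "\<gamma> \<in> carrier P"
  shows "inv\<^bsub>P\<^esub> \<gamma> = (\<lambda>t\<in>{0..1}. inv (\<gamma> t))"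
  using assms inv_path_closed[OF assms]
  by (intro P.inv_equality) (auto simp: mult_path_group one_path_group intro!: restrict_ext)

section \<open>Homotopy classes of paths and their group structure\<close>

lemma path_homotopy_rel_iff:
  "(\<gamma>, \<delta>) \<in> R \<longleftrightarrow> \<gamma> \<in> carrier P \<and> \<delta> \<in> carrier P \<and>
     (\<exists>h. continuous_map (prod_topology I I) T h \<and>
       (\<forall>t\<in>{0..1}. h (0, t) = \<gamma> t) \<and> (\<forall>t\<in>{0..1}. h (1, t) = \<delta> t) \<and>
       (\<forall>s\<in>{0..1}. h (s, 0) = \<one> \<and> h (s, 1) = \<gamma> 1))"
proof (cases "\<gamma> \<in> carrier P \<and> \<delta> \<in> carrier P")
  case True
  then have "\<gamma> 0 = \<one>"
    by (simp add: mem_carrier_path_group)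
  then show ?thesis
    using True unfolding path_homotopy_rel_def by (simp add: homotopic_with)
qed (auto simp: path_homotopy_rel_def)

lemma equiv_path_homotopy_rel: "equiv (carrier P) R"
proof (rule equivI)
  show "R \<subseteq> carrier P \<times> carrier P"
    by (auto simp: path_homotopy_rel_def)
  show "refl_on (carrier P) R"
    by (auto simp: refl_on_def path_homotopy_rel_def mem_carrier_path_group)
  \<comment> \<open>The side condition on the homotopy names the endpoints of the first path only.
    Symmetry and transitivity change the first path, so equality of endpoints is needed to match the
    conditions.\<close>
  have endpoints: "\<gamma> 0 = \<delta> 0" "\<gamma> 1 = \<delta> 1" if "(\<gamma>, \<delta>) \<in> R" for \<gamma> \<delta>
  proof -
    have "homotopic_with (\<lambda>h. h 0 = \<gamma> 0 \<and> h 1 = \<gamma> 1) I T \<gamma> \<delta>"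
      using that by (simp add: path_homotopy_rel_def)
    then show "\<gamma> 0 = \<delta> 0" "\<gamma> 1 = \<delta> 1"
      by (auto dest: homotopic_with_imp_property)
  qed
  show "sym R"
  proof (rule symI)
    fix \<gamma> \<delta> assume *: "(\<gamma>, \<delta>) \<in> R"
    then show "(\<delta>, \<gamma>) \<in> R"
      using endpoints[OF *] by (simp add: path_homotopy_rel_def homotopic_with_sym)
  qed
  show "trans R"
  proof (rule transI)
    fix \<gamma> \<delta> \<epsilon> assume *: "(\<gamma>, \<delta>) \<in> R" "(\<delta>, \<epsilon>) \<in> R"
    let ?Q = "\<lambda>h. h 0 = \<gamma> 0 \<and> h 1 = \<gamma> 1"
    have "homotopic_with ?Q I T \<gamma> \<delta>" "homotopic_with ?Q I T \<delta> \<epsilon>"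
      using * endpoints[OF *(1)] by (auto simp: path_homotopy_rel_def)
    then have "homotopic_with ?Q I T \<gamma> \<epsilon>"
      by (rule homotopic_with_trans)
    then show "(\<gamma>, \<epsilon>) \<in> R"
      using * by (simp add: path_homotopy_rel_def)
  qed
qed

text \<open>The pointwise product of two homotopies is a homotopy between the products, by
  continuity of multiplication.\<close>

lemma path_homotopy_rel_mult:
  assumes "(\<gamma>, \<gamma>') \<in> R" "(\<delta>, \<delta>') \<in> R"
  shows "(\<gamma> \<otimes>\<^bsub>P\<^esub> \<delta>, \<gamma>' \<otimes>\<^bsub>P\<^esub> \<delta>') \<in> R"
proof -
  obtain h where h: "\<gamma> \<in> carrier P" "\<gamma>' \<in> carrier P" "continuous_map (prod_topology I I) T h"
      "\<forall>t\<in>{0..1}. h (0, t) = \<gamma> t" "\<forall>t\<in>{0..1}. h (1, t) = \<gamma>' t"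
      "\<forall>s\<in>{0..1}. h (s, 0) = \<one> \<and> h (s, 1) = \<gamma> 1"
    using assms(1) unfolding path_homotopy_rel_iff by blast
  obtain k where k: "\<delta> \<in> carrier P" "\<delta>' \<in> carrier P" "continuous_map (prod_topology I I) T k"
      "\<forall>t\<in>{0..1}. k (0, t) = \<delta> t" "\<forall>t\<in>{0..1}. k (1, t) = \<delta>' t"
      "\<forall>s\<in>{0..1}. k (s, 0) = \<one> \<and> k (s, 1) = \<delta> 1"
    using assms(2) unfolding path_homotopy_rel_iff by blast
  have "continuous_map (prod_topology I I) T (\<lambda>z. h z \<otimes> k z)"
    using h(3) k(3) by (rule continuous_map_mult)
  then show ?thesis
    unfolding path_homotopy_rel_iff
    by (intro conjI exI[of _ "\<lambda>z. h z \<otimes> k z"] P.m_closed)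
       (use h k in \<open>auto simp: mult_path_group\<close>)
qed

lemma cls_eq: "(\<gamma>, \<delta>) \<in> R \<Longrightarrow> cls \<gamma> = cls \<delta>"
  unfolding cls_def by (rule equiv_class_eq[OF equiv_path_homotopy_rel])

text \<open>The union defining the product runs over nonempty sets of representatives, and all its
  terms are the same class.\<close>

lemma mult_cls:
  assumes "\<gamma> \<in> carrier P" "\<delta> \<in> carrier P"
  shows "cls \<gamma> \<otimes>\<^bsub>Cov\<^esub> cls \<delta> = cls (\<gamma> \<otimes>\<^bsub>P\<^esub> \<delta>)"
proof -
  have "cls (\<gamma>' \<otimes>\<^bsub>P\<^esub> \<delta>') = cls (\<gamma> \<otimes>\<^bsub>P\<^esub> \<delta>)" if "\<gamma>' \<in> cls \<gamma>" "\<delta>' \<in> cls \<delta>" for \<gamma>' \<delta>'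
    using that by (metis Image_singleton_iff cls_def cls_eq path_homotopy_rel_mult)
  moreover have "\<gamma> \<in> cls \<gamma>" "\<delta> \<in> cls \<delta>"
    using assms unfolding cls_def by (intro equiv_class_self[OF equiv_path_homotopy_rel]; simp)+
  ultimately have "(\<Union>\<gamma>'\<in>cls \<gamma>. \<Union>\<delta>'\<in>cls \<delta>. cls (\<gamma>' \<otimes>\<^bsub>P\<^esub> \<delta>')) = cls (\<gamma> \<otimes>\<^bsub>P\<^esub> \<delta>)"
    by blast
  then show ?thesis
    by (simp add: universal_covering_group_def cls_def)
qed

lemma carrier_universal_covering_group: "carrier Cov = cls ` carrier P"
  by (auto simp: universal_covering_group_def cls_def quotient_def)

lemma cls_hom: "cls \<in> hom P Cov"
  by (auto simp: hom_def mult_cls carrier_universal_covering_group)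

lemma group_universal_covering_group: "group Cov"
proof -
  \<comment> \<open>The image of a group under a homomorphism is a group once carrier and unit are
    replaced by their images; here both replacements change nothing.\<close>
  have "Cov\<lparr>carrier := cls ` carrier P, one := cls \<one>\<^bsub>P\<^esub>\<rparr> = Cov"
    unfolding carrier_universal_covering_group[symmetric]
    by (simp add: universal_covering_group_def cls_def)
  then show ?thesis
    using P.hom_imp_img_group[OF cls_hom] by simp
qed

sublocale Cov: group Cov
  by (rule group_universal_covering_group)

sublocale cls: group_hom P Cov cls
  by unfold_locales (rule cls_hom)

section \<open>Conjugation in the universal covering group\<close>

lemma continuous_map_max: "continuous_map (prod_topology I I) I (\<lambda>z. max (fst z) (snd z))"
proof -
  have "continuous_map (prod_topology I I) euclideanreal fst"
       "continuous_map (prod_topology I I) euclideanreal snd"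
    by (blast intro: continuous_map_into_fulltopology continuous_map_fst continuous_map_snd)+
  then show ?thesis
    by (auto simp: continuous_map_in_subtopology intro: continuous_on_max)
qed

definition end_conj :: "(real \<Rightarrow> 'g) \<Rightarrow> (real \<Rightarrow> 'g) \<Rightarrow> real \<Rightarrow> 'g" where
  "end_conj \<eta> \<gamma> = (\<lambda>t\<in>{0..1}. \<eta> 1 \<otimes> \<gamma> t \<otimes> inv (\<eta> 1))"

lemma end_conj_closed:
  assumes "\<eta> \<in> carrier P" "\<gamma> \<in> carrier P"
  shows "end_conj \<eta> \<gamma> \<in> carrier P"
  unfolding end_conj_def
  using assms mem_carrier_path_group[of \<gamma>]
  by (intro restrict_in_path_group continuous_map_mult) auto

lemma conj_homotopic_end_conj:
  assumes \<eta>: "\<eta> \<in> carrier P" and \<gamma>: "\<gamma> \<in> carrier P"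
  shows "(\<eta> \<otimes>\<^bsub>P\<^esub> \<gamma> \<otimes>\<^bsub>P\<^esub> inv\<^bsub>P\<^esub> \<eta>, end_conj \<eta> \<gamma>) \<in> R"
proof -
  \<comment> \<open>The first coordinate \<open>s\<close> is the homotopy parameter, the second
    \<open>t\<close> is time. For \<open>s = 0\<close> the maximum is \<open>t\<close>, giving the
    pointwise conjugate; for \<open>s = 1\<close> it is \<open>1\<close>, giving
    \<open>end_conj\<close>. At \<open>t = 0\<close> the value is the unit because
    \<open>\<gamma> 0\<close> is, and at \<open>t = 1\<close> the maximum does not depend on
    \<open>s\<close>.\<close>
  let ?m = "\<lambda>z::real\<times>real. max (fst z) (snd z)"
  let ?h = "\<lambda>z. \<eta> (?m z) \<otimes> \<gamma> (snd z) \<otimes> inv (\<eta> (?m z))"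
  have "continuous_map (prod_topology I I) T (\<eta> \<circ> ?m)"
    using \<eta> continuous_map_max unfolding mem_carrier_path_group
    by (intro continuous_map_compose) auto
  moreover have "continuous_map (prod_topology I I) T (\<gamma> \<circ> snd)"
    using \<gamma> unfolding mem_carrier_path_group
    by (blast intro: continuous_map_compose[OF continuous_map_snd])
  ultimately have "continuous_map (prod_topology I I) T ?h"
    by (intro continuous_map_mult continuous_map_inv) (simp_all add: o_def)
  moreover have "\<gamma> 0 = \<one>"
    using \<gamma> by (simp add: mem_carrier_path_group)
  ultimately show ?thesis
    unfolding path_homotopy_rel_iff
    using \<eta> \<gamma> end_conj_closed[OF \<eta> \<gamma>]
    by (intro conjI exI[of _ ?h] P.m_closed P.inv_closed)
       (auto simp: mult_path_group inv_path_group end_conj_def max_def)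
qed

lemma cls_conj:
  assumes "\<eta> \<in> carrier P" "\<gamma> \<in> carrier P"
  shows "cls \<eta> \<otimes>\<^bsub>Cov\<^esub> cls \<gamma> \<otimes>\<^bsub>Cov\<^esub> inv\<^bsub>Cov\<^esub> cls \<eta> = cls (end_conj \<eta> \<gamma>)"
  using cls_eq[OF conj_homotopic_end_conj[OF assms]] assms
  by simp

text \<open>Induction over the factors, extending \<open>commutator_mult_left_in_normal\<close> from
  two factors to a list; the empty product gives the trivial commutator.\<close>

lemma commutator_cls_foldr_in_normal:
  assumes N: "N \<lhd> Cov" and fs: "set fs \<subseteq> carrier P" and b: "b \<in> carrier Cov"
    and comm: "\<And>f. f \<in> set fs \<Longrightarrow> cls f \<otimes>\<^bsub>Cov\<^esub> b \<otimes>\<^bsub>Cov\<^esub> inv\<^bsub>Cov\<^esub> cls f \<otimes>\<^bsub>Cov\<^esub> inv\<^bsub>Cov\<^esub> b \<in> N"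
  defines "f \<equiv> foldr (\<otimes>\<^bsub>P\<^esub>) fs \<one>\<^bsub>P\<^esub>"
  shows "cls f \<otimes>\<^bsub>Cov\<^esub> b \<otimes>\<^bsub>Cov\<^esub> inv\<^bsub>Cov\<^esub> cls f \<otimes>\<^bsub>Cov\<^esub> inv\<^bsub>Cov\<^esub> b \<in> N"
  unfolding f_def using fs comm
proof (induction fs)
  case Nil
  interpret N: normal N Cov by fact
  show ?case
    using b by (simp add: cls.hom_one)
next
  case (Cons g fs)
  have fs: "foldr (\<otimes>\<^bsub>P\<^esub>) fs \<one>\<^bsub>P\<^esub> \<in> carrier P"
    using Cons.prems(1) by (induction fs) auto
  show ?case
    using Cons fs b Cov.commutator_mult_left_in_normal[OF N, of "cls g" "cls (foldr (\<otimes>\<^bsub>P\<^esub>) fs \<one>\<^bsub>P\<^esub>)" b]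
    by simp
qed

end

section \<open>Regularity of paracompact spaces\<close>

text \<open>The classical argument: Hausdorff separation of \<open>x\<close> from single points of
  \<open>C\<close> is upgraded to separation from all of \<open>C\<close> by a locally finite
  refinement.\<close>

lemma paracompact_imp_regular_space:
  assumes "paracompact_space X"
  shows "regular_space X"
proof -
  have Hausdorff: "Hausdorff_space X"
    and refinement: "\<And>\<U>. (\<forall>U\<in>\<U>. openin X U) \<Longrightarrow> \<Union>\<U> = topspace X \<Longrightarrow>
        \<exists>\<V>. (\<forall>V\<in>\<V>. openin X V) \<and> \<Union>\<V> = topspace X \<and>
             (\<forall>V\<in>\<V>. \<exists>U\<in>\<U>. V \<subseteq> U) \<and> locally_finite_in X \<V>"
    using assms unfolding paracompact_space_def by auto
  show ?thesis
    unfolding regular_space_def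
  proof (intro allI impI)
    fix C x assume Cx: "closedin X C \<and> x \<in> topspace X - C"
    \<comment> \<open>Each point of \<open>C\<close> has an open neighbourhood disjoint from a
      neighbourhood of \<open>x\<close>, hence one whose closure misses \<open>x\<close>; the
      complement of \<open>C\<close> covers the rest.\<close>
    define \<U> where "\<U> = insert (topspace X - C) {V. openin X V \<and> x \<notin> X closure_of V}"
    have "y \<in> \<Union>\<U>" if y: "y \<in> topspace X" for y
    proof (cases "y \<in> C")
      case True
      then obtain A B where "openin X A" "openin X B" "x \<in> A" "y \<in> B" "disjnt A B"
        using Hausdorff Cx y unfolding Hausdorff_space_def by (metis DiffD1 DiffD2)
      then show ?thesis
        unfolding \<U>_def by (fastforce simp: in_closure_of disjnt_iff)
    qed (use y \<U>_def in auto)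
    moreover have open_\<U>: "openin X U" if "U \<in> \<U>" for U
      using that Cx by (auto simp: \<U>_def)
    ultimately have "\<Union>\<U> = topspace X"
      using openin_subset by blast
    with refinement[of \<U>] open_\<U> obtain \<V> where \<V>: "\<forall>V\<in>\<V>. openin X V" "\<Union>\<V> = topspace X"
        "\<forall>V\<in>\<V>. \<exists>U\<in>\<U>. V \<subseteq> U" "locally_finite_in X \<V>"
      by blast
    define \<W> where "\<W> = {V \<in> \<V>. V \<inter> C \<noteq> {}}"
    \<comment> \<open>A member that meets \<open>C\<close> is not inside the complement of
      \<open>C\<close>, so it refines a set whose closure misses \<open>x\<close>.\<close>
    have "x \<notin> X closure_of V" if V: "V \<in> \<W>" for V
    proof -
      obtain U where "U \<in> \<U>" "V \<subseteq> U" "V \<inter> C \<noteq> {}"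
        using \<V>(3) V unfolding \<W>_def by blast
      then have "x \<notin> X closure_of U"
        unfolding \<U>_def by blast
      then show ?thesis
        using \<open>V \<subseteq> U\<close> closure_of_mono by blast
    qed
    moreover have "locally_finite_in X \<W>"
      using \<V>(4) by (rule locally_finite_in_subset) (simp add: \<W>_def)
    \<comment> \<open>For a locally finite family the closure of the union is the union of the
      closures.\<close>
    ultimately have x: "x \<notin> X closure_of \<Union>\<W>"
      by (auto simp: closure_of_locally_finite_Union)
    have opn: "openin X (\<Union>\<W>)"
      using \<V>(1) by (auto simp: \<W>_def)
    have "C \<subseteq> \<Union>\<W>"
      using Cx closedin_subset[of X C] \<V>(2) unfolding \<W>_def by blast
    moreover have "disjnt (topspace X - X closure_of \<Union>\<W>) (\<Union>\<W>)"
      using closure_of_subset[OF openin_subset[OF opn]] by (auto simp: disjnt_iff)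
    ultimately show "\<exists>U V. openin X U \<and> openin X V \<and> x \<in> U \<and> C \<subseteq> V \<and> disjnt U V"
      using Cx x opn by (intro exI[of _ "topspace X - X closure_of \<Union>\<W>"] exI[of _ "\<Union>\<W>"]) auto
  qed
qed

section \<open>Paths of homeomorphisms\<close>

locale homeo_top_group =
  top_group "homeo_subgroup X G" "homeo_subgroup_topology X G"
  for X :: "'a topology" and G :: "('a \<Rightarrow> 'a) set" +
  assumes subgroup_G: "subgroup G (homeo_group X)"
begin

abbreviation "M \<equiv> homeo_subgroup X G"

lemma homeomorphic_map_mem: "f \<in> G \<Longrightarrow> homeomorphic_map X X f"
  and extensional_mem: "f \<in> G \<Longrightarrow> f \<in> extensional (topspace X)"
  using subgroup.subset[OF subgroup_G] by (auto simp: homeo_group_def)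

lemma Bij_mem: "f \<in> G \<Longrightarrow> f \<in> Bij (topspace X)"
  using homeomorphic_map_mem[of f] extensional_mem[of f] homeomorphic_imp_injective_map[of X X f]
    homeomorphic_imp_surjective_map[of X X f]
  by (auto simp: Bij_def bij_betw_def)

lemma mem_apply_closed [simp]: "f \<in> G \<Longrightarrow> x \<in> topspace X \<Longrightarrow> f x \<in> topspace X"
  using Bij_imp_funcset[OF Bij_mem] by blast

lemma mult_apply [simp]:
  assumes "f \<in> G" "g \<in> G" "x \<in> topspace X"
  shows "(f \<otimes>\<^bsub>homeo_group X\<^esub> g) x = f (g x)"
  using assms Bij_mem by (simp add: homeo_group_def BijGroup_def compose_def)

lemma one_apply [simp]: "x \<in> topspace X \<Longrightarrow> \<one>\<^bsub>homeo_group X\<^esub> x = x"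
  by (simp add: homeo_group_def BijGroup_def)

lemma mult_mem [simp]: "f \<in> G \<Longrightarrow> g \<in> G \<Longrightarrow> f \<otimes>\<^bsub>homeo_group X\<^esub> g \<in> G"
  using m_closed[of f g] by simp

lemma inv_mem [simp]: "f \<in> G \<Longrightarrow> inv\<^bsub>M\<^esub> f \<in> G"
  using inv_closed[of f] by simp

lemma inv_apply [simp]:
  assumes "f \<in> G" "x \<in> topspace X"
  shows "(inv\<^bsub>M\<^esub> f) (f x) = x" "f ((inv\<^bsub>M\<^esub> f) x) = x"
proof -
  have "(inv\<^bsub>M\<^esub> f \<otimes>\<^bsub>M\<^esub> f) x = x" "(f \<otimes>\<^bsub>M\<^esub> inv\<^bsub>M\<^esub> f) x = x"
    using assms l_inv[of f] r_inv[of f] by simp_all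
  then show "(inv\<^bsub>M\<^esub> f) (f x) = x" "f ((inv\<^bsub>M\<^esub> f) x) = x"
    using assms by simp_all
qed

lemma path_mem [simp]: "\<gamma> \<in> carrier P \<Longrightarrow> t \<in> {0..1} \<Longrightarrow> \<gamma> t \<in> G"
  using path_group_closed by simp

section \<open>Supports and commutation\<close>

definition fixes_outside :: "'a set \<Rightarrow> (real \<Rightarrow> 'a \<Rightarrow> 'a) \<Rightarrow> bool" where
  "fixes_outside A \<gamma> \<longleftrightarrow> (\<forall>t\<in>{0..1}. \<forall>x\<in>topspace X - A. \<gamma> t x = x)"

text \<open>Forgets the closures in \<open>supp\<close>: being the identity off a set is what the
  commutation argument uses, and it is carried along by bijections.\<close>

lemma path_supp_imp_fixes_outside:
  assumes "path_supp X \<gamma> \<subseteq> A"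
  shows "fixes_outside A \<gamma>"
  unfolding fixes_outside_def
proof (intro ballI)
  fix t x assume t: "t \<in> {0..1::real}" and x: "x \<in> topspace X - A"
  have "{x \<in> topspace X. \<gamma> t x \<noteq> x} \<subseteq> supp X (\<gamma> t)"
    unfolding supp_def by (rule closure_of_subset) auto
  also have "\<dots> \<subseteq> A"
    using t assms unfolding path_supp_def by blast
  finally show "\<gamma> t x = x"
    using x by blast
qed

lemma fixes_outside_mono: "fixes_outside A \<gamma> \<Longrightarrow> A \<subseteq> B \<Longrightarrow> fixes_outside B \<gamma>"
  unfolding fixes_outside_def by blast

lemma commute_if_disjoint:
  assumes \<gamma>: "\<gamma> \<in> carrier P" "fixes_outside A \<gamma>"
    and \<delta>: "\<delta> \<in> carrier P" "fixes_outside B \<delta>"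
    and "A \<inter> B = {}"
  shows "\<gamma> \<otimes>\<^bsub>P\<^esub> \<delta> = \<delta> \<otimes>\<^bsub>P\<^esub> \<gamma>"
proof -
  have "\<gamma> t \<otimes>\<^bsub>M\<^esub> \<delta> t = \<delta> t \<otimes>\<^bsub>M\<^esub> \<gamma> t" if t: "t \<in> {0..1}" for t
  proof (rule extensionalityI[where A = "topspace X"])
    have G: "\<gamma> t \<in> G" "\<delta> t \<in> G"
      using t \<gamma> \<delta> by auto
    show "\<gamma> t \<otimes>\<^bsub>M\<^esub> \<delta> t \<in> extensional (topspace X)"
         "\<delta> t \<otimes>\<^bsub>M\<^esub> \<gamma> t \<in> extensional (topspace X)"
      using G by (simp_all add: extensional_mem)
    fix x assume x: "x \<in> topspace X"
    have A: "\<gamma> t z = z" if "z \<in> topspace X" "z \<notin> A" for z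
      using that \<gamma>(2) t by (auto simp: fixes_outside_def)
    have B: "\<delta> t z = z" if "z \<in> topspace X" "z \<notin> B" for z
      using that \<delta>(2) t by (auto simp: fixes_outside_def)
    \<comment> \<open>By injectivity: if \<open>\<gamma> t x\<close> were outside \<open>A\<close>,
      it would be fixed by \<open>\<gamma> t\<close>, which forces \<open>\<gamma> t x = x\<close>,
      a point of \<open>A\<close>.\<close>
    have "\<gamma> t x \<in> A" if "x \<in> A"
      using A[of "\<gamma> t x"] that x G inv_apply(1) mem_apply_closed by metis
    moreover have "\<delta> t x \<in> B" if "x \<in> B"
      using B[of "\<delta> t x"] that x G inv_apply(1) mem_apply_closed by metis
    ultimately have "\<gamma> t (\<delta> t x) = \<delta> t (\<gamma> t x)"
      using A B x G assms(5) by (metis disjoint_iff mem_apply_closed)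
    then show "(\<gamma> t \<otimes>\<^bsub>M\<^esub> \<delta> t) x = (\<delta> t \<otimes>\<^bsub>M\<^esub> \<gamma> t) x"
      using x G by simp
  qed
  then show ?thesis
    by (auto simp: mult_path_group intro!: restrict_ext)
qed

lemma cls_commute_if_disjoint:
  assumes "\<gamma> \<in> carrier P" "fixes_outside A \<gamma>"
    and "\<delta> \<in> carrier P" "fixes_outside B \<delta>"
    and "A \<inter> B = {}"
  shows "cls \<gamma> \<otimes>\<^bsub>Cov\<^esub> cls \<delta> = cls \<delta> \<otimes>\<^bsub>Cov\<^esub> cls \<gamma>"
  using commute_if_disjoint[OF assms] assms(1,3) by (metis mult_cls)

text \<open>A point off the image of \<open>A\<close> has its preimage under \<open>\<eta> 1\<close>
  off \<open>A\<close>, where \<open>\<gamma> t\<close> is the identity.\<close>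

lemma end_conj_fixes_outside:
  assumes \<eta>: "\<eta> \<in> carrier P" and \<gamma>: "\<gamma> \<in> carrier P" "fixes_outside A \<gamma>"
  shows "fixes_outside (\<eta> 1 ` A) (end_conj \<eta> \<gamma>)"
  unfolding fixes_outside_def
proof (intro ballI)
  fix t x assume t: "t \<in> {0..1::real}" and x: "x \<in> topspace X - \<eta> 1 ` A"
  let ?y = "(inv\<^bsub>M\<^esub> (\<eta> 1)) x"
  have G: "\<eta> 1 \<in> G" "\<gamma> t \<in> G"
    using \<eta> \<gamma> t by auto
  have "\<eta> 1 ?y = x" "?y \<in> topspace X"
    using G x by auto
  then have "?y \<in> topspace X - A"
    using x by force
  then have "\<gamma> t ?y = ?y"
    using \<gamma>(2) t by (simp add: fixes_outside_def)
  then show "end_conj \<eta> \<gamma> t x = x"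
    using t x G by (simp add: end_conj_def)
qed

text \<open>By \<open>cls_conj\<close>, conjugating by \<open>cls \<eta>\<close> and
  \<open>cls \<theta>\<close> moves the two supports to \<open>\<eta> 1\<close>
  A\<open>and\<close>\<theta> 1 \<open>A\<close>; the three disjointness conditions are exactly the
  three commutation hypotheses of \<open>commutator_in_derived_derived\<close>.\<close>

lemma commutator_displaced:
  assumes "\<gamma> \<in> carrier P" "fixes_outside A \<gamma>" "\<delta> \<in> carrier P" "fixes_outside A \<delta>"
    and \<eta>: "\<eta> \<in> carrier P" and \<theta>: "\<theta> \<in> carrier P"
    and disj: "A \<inter> \<eta> 1 ` A = {}" "A \<inter> \<theta> 1 ` A = {}" "\<eta> 1 ` A \<inter> \<theta> 1 ` A = {}"
  shows "cls \<gamma> \<otimes>\<^bsub>Cov\<^esub> cls \<delta> \<otimes>\<^bsub>Cov\<^esub> inv\<^bsub>Cov\<^esub> cls \<gamma> \<otimes>\<^bsub>Cov\<^esub> inv\<^bsub>Cov\<^esub> cls \<delta>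
    \<in> derived Cov (derived Cov (carrier Cov))"
proof (rule Cov.commutator_in_derived_derived[where p = "cls \<eta>" and q = "cls \<theta>"])
  note closed = end_conj_closed[OF \<eta> assms(1)] end_conj_closed[OF \<theta> assms(3)]
  note outside = end_conj_fixes_outside[OF \<eta> assms(1,2)] end_conj_fixes_outside[OF \<theta> assms(3,4)]
  show "cls \<gamma> \<in> carrier Cov" "cls \<delta> \<in> carrier Cov" "cls \<eta> \<in> carrier Cov" "cls \<theta> \<in> carrier Cov"
    using assms by auto
  show "cls \<eta> \<otimes>\<^bsub>Cov\<^esub> cls \<gamma> \<otimes>\<^bsub>Cov\<^esub> inv\<^bsub>Cov\<^esub> cls \<eta> \<otimes>\<^bsub>Cov\<^esub> cls \<delta>
      = cls \<delta> \<otimes>\<^bsub>Cov\<^esub> (cls \<eta> \<otimes>\<^bsub>Cov\<^esub> cls \<gamma> \<otimes>\<^bsub>Cov\<^esub> inv\<^bsub>Cov\<^esub> cls \<eta>)"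
    unfolding cls_conj[OF \<eta> assms(1)]
    using disj by (intro cls_commute_if_disjoint[OF closed(1) outside(1) assms(3,4)]) auto
  show "cls \<gamma> \<otimes>\<^bsub>Cov\<^esub> (cls \<theta> \<otimes>\<^bsub>Cov\<^esub> cls \<delta> \<otimes>\<^bsub>Cov\<^esub> inv\<^bsub>Cov\<^esub> cls \<theta>)
      = cls \<theta> \<otimes>\<^bsub>Cov\<^esub> cls \<delta> \<otimes>\<^bsub>Cov\<^esub> inv\<^bsub>Cov\<^esub> cls \<theta> \<otimes>\<^bsub>Cov\<^esub> cls \<gamma>"
    unfolding cls_conj[OF \<theta> assms(3)]
    using disj by (intro cls_commute_if_disjoint[OF assms(1,2) closed(2) outside(2)]) auto
  show "cls \<eta> \<otimes>\<^bsub>Cov\<^esub> cls \<gamma> \<otimes>\<^bsub>Cov\<^esub> inv\<^bsub>Cov\<^esub> cls \<eta> \<otimes>\<^bsub>Cov\<^esub> (cls \<theta> \<otimes>\<^bsub>Cov\<^esub> cls \<delta> \<otimes>\<^bsub>Cov\<^esub> inv\<^bsub>Cov\<^esub> cls \<theta>)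
      = cls \<theta> \<otimes>\<^bsub>Cov\<^esub> cls \<delta> \<otimes>\<^bsub>Cov\<^esub> inv\<^bsub>Cov\<^esub> cls \<theta> \<otimes>\<^bsub>Cov\<^esub> (cls \<eta> \<otimes>\<^bsub>Cov\<^esub> cls \<gamma> \<otimes>\<^bsub>Cov\<^esub> inv\<^bsub>Cov\<^esub> cls \<eta>)"
    unfolding cls_conj[OF \<eta> assms(1)] cls_conj[OF \<theta> assms(3)]
    using disj by (intro cls_commute_if_disjoint[OF closed(1) outside(1) closed(2) outside(2)]) auto
qed

section \<open>Orbits of the identity component\<close>

lemma continuous_map_evaluation:
  assumes x: "x \<in> topspace X"
  shows "continuous_map (homeo_subgroup_topology X G) X (\<lambda>f. f x)"
  unfolding continuous_map_def
proof (intro conjI allI impI)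
  show "(\<lambda>f. f x) \<in> topspace (homeo_subgroup_topology X G) \<rightarrow> topspace X"
    using x by (simp add: topspace_T)
  fix V assume V: "openin X V"
  \<comment> \<open>A one-point set is compact, so this is a generating open set of the compact-open
    topology.\<close>
  let ?B = "{f \<in> extensional (topspace X). continuous_map X X f \<and> f ` {x} \<subseteq> V}"
  have "openin (compact_open_topology X X) ?B"
    unfolding compact_open_topology_def
    by (intro topology_generated_by_Basis CollectI exI[of _ "{x}"] exI[of _ V]) (use x V in auto)
  moreover have "{f \<in> topspace (homeo_subgroup_topology X G). f x \<in> V} = G \<inter> ?B"
    unfolding topspace_T
    using extensional_mem homeomorphic_imp_continuous_map[OF homeomorphic_map_mem] by auto
  ultimately show "openin (homeo_subgroup_topology X G)
      {f \<in> topspace (homeo_subgroup_topology X G). f x \<in> V}"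
    by (auto simp: openin_subtopology_Int2)
qed

text \<open>Shows that every intermediate value \<open>\<eta> t\<close> is itself the endpoint of a
  path from the identity.\<close>

lemma initial_path_closed:
  assumes \<eta>: "\<eta> \<in> carrier P" and t: "t \<in> {0..1}"
  shows "(\<lambda>s\<in>{0..1}. \<eta> (t * s)) \<in> carrier P"
proof (rule restrict_in_path_group)
  have "continuous_map I I (\<lambda>s. t * s)"
    using t by (auto simp: continuous_map_in_subtopology mult_le_one intro!: continuous_intros)
  then have "continuous_map I (homeo_subgroup_topology X G) (\<eta> \<circ> (\<lambda>s. t * s))"
    using \<eta> unfolding mem_carrier_path_group by (blast intro: continuous_map_compose)
  then show "continuous_map I (homeo_subgroup_topology X G) (\<lambda>s. \<eta> (t * s))"
    by (simp add: o_def)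
qed (use \<eta> in \<open>simp add: mem_carrier_path_group\<close>)

text \<open>The track \<open>t \<mapsto> \<eta> t x\<close> of a moved point is connected, Hausdorff
  and not a single point, hence infinite. So it contains a third point \<open>\<eta> t x\<close>,
  reached by the initial piece of \<open>\<eta>\<close>.\<close>

lemma three_orbit_points:
  assumes X: "Hausdorff_space X"
    and nonfix: "non_fixing X (identity_component (homeo_subgroup_topology X G) M)"
    and x: "x \<in> topspace X"
  obtains \<eta> \<theta> where "\<eta> \<in> carrier P" "\<theta> \<in> carrier P" "\<eta> 1 x \<noteq> x" "\<theta> 1 x \<noteq> x" "\<theta> 1 x \<noteq> \<eta> 1 x"
proof -
  let ?G0 = "identity_component (homeo_subgroup_topology X G) M"
  \<comment> \<open>The point \<open>x\<close> lies in its own orbit, so an orbit different from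
    \<open>{x}\<close> must contain another point.\<close>
  have "\<one>\<^bsub>P\<^esub> 1 \<in> ?G0"
    using path_mem[OF P.one_closed, of 1] unfolding identity_component_def by auto
  moreover have "x = \<one>\<^bsub>P\<^esub> 1 x"
    using x by (simp add: one_path_group)
  ultimately have "x \<in> {h x |h. h \<in> ?G0}"
    by blast
  then obtain g where "g \<in> ?G0" "g x \<noteq> x"
    using nonfix x unfolding non_fixing_def by blast
  then obtain \<eta> where \<eta>: "\<eta> \<in> carrier P" "\<eta> 1 x \<noteq> x"
    unfolding identity_component_def by auto
  have \<eta>0: "\<eta> 0 x = x"
    using \<eta>(1) x by (simp add: mem_carrier_path_group)
  let ?c = "\<lambda>t. \<eta> t x"
  have "continuous_map I X ((\<lambda>f. f x) \<circ> \<eta>)"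
    using \<eta>(1) continuous_map_evaluation[OF x]
    unfolding mem_carrier_path_group by (blast intro: continuous_map_compose)
  then have c: "continuous_map I X ?c"
    by (simp add: o_def)
  have "connectedin I {0..1}"
    by (simp add: connectedin_subtopology)
  then have "connectedin X (?c ` {0..1})"
    using c connectedin_continuous_map_image by blast
  then have conn: "connected_space (subtopology X (?c ` {0..1}))"
    and sub: "?c ` {0..1} \<subseteq> topspace X"
    by (auto simp: connectedin_def)
  have top: "topspace (subtopology X (?c ` {0..1})) = ?c ` {0..1}"
    using sub by (simp add: inf_absorb2)
  have "\<eta> 0 x \<in> ?c ` {0..1}" "\<eta> 1 x \<in> ?c ` {0..1}"
    by (rule imageI; simp)+
  then have "\<nexists>a. ?c ` {0..1} \<subseteq> {a}"
    using \<eta>(2) \<eta>0 by (metis singletonD subsetD)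
  then have "infinite (?c ` {0..1})"
    using connected_space_imp_infinite[OF conn Hausdorff_space_subtopology[OF X]]
    unfolding top by blast
  then have "\<not> ?c ` {0..1} \<subseteq> {x, \<eta> 1 x}"
    using finite_subset by blast
  then obtain t where t: "t \<in> {0..1}" "\<eta> t x \<noteq> x" "\<eta> t x \<noteq> \<eta> 1 x"
    by blast
  show ?thesis
    using that[OF \<eta>(1) initial_path_closed[OF \<eta>(1) t(1)]] \<eta>(2) t by simp
qed

text \<open>The points \<open>x\<close>, \<open>\<eta> 1 x\<close>, \<open>\<theta> 1 x\<close> are
  separated pairwise by open sets, and these are pulled back to \<open>x\<close> by
  continuity.\<close>

lemma displaced_neighbourhood:
  assumes X: "Hausdorff_space X"
    and nonfix: "non_fixing X (identity_component (homeo_subgroup_topology X G) M)"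
    and x: "x \<in> topspace X"
  obtains V \<eta> \<theta> where "openin X V" "x \<in> V" "\<eta> \<in> carrier P" "\<theta> \<in> carrier P"
    "V \<inter> \<eta> 1 ` V = {}" "V \<inter> \<theta> 1 ` V = {}" "\<eta> 1 ` V \<inter> \<theta> 1 ` V = {}"
proof -
  obtain \<eta> \<theta> where \<eta>: "\<eta> \<in> carrier P" and \<theta>: "\<theta> \<in> carrier P"
    and neq: "\<eta> 1 x \<noteq> x" "\<theta> 1 x \<noteq> x" "\<theta> 1 x \<noteq> \<eta> 1 x"
    using three_orbit_points[OF assms] by metis
  have G: "\<eta> 1 \<in> G" "\<theta> 1 \<in> G"
    using \<eta> \<theta> by auto
  have top: "\<eta> 1 x \<in> topspace X" "\<theta> 1 x \<in> topspace X"
    using G x by auto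
  obtain A1 B1 where 1: "openin X A1" "openin X B1" "x \<in> A1" "\<eta> 1 x \<in> B1" "disjnt A1 B1"
    using X x top neq unfolding Hausdorff_space_def by metis
  obtain A2 C2 where 2: "openin X A2" "openin X C2" "x \<in> A2" "\<theta> 1 x \<in> C2" "disjnt A2 C2"
    using X x top neq unfolding Hausdorff_space_def by metis
  obtain B3 C3 where 3: "openin X B3" "openin X C3" "\<eta> 1 x \<in> B3" "\<theta> 1 x \<in> C3" "disjnt B3 C3"
    using X x top neq unfolding Hausdorff_space_def by metis
  define V where "V = A1 \<inter> A2 \<inter> {z \<in> topspace X. \<eta> 1 z \<in> B1 \<inter> B3} \<inter> {z \<in> topspace X. \<theta> 1 z \<in> C2 \<inter> C3}"
  have sub: "V \<subseteq> A1" "V \<subseteq> A2" "\<eta> 1 ` V \<subseteq> B1" "\<eta> 1 ` V \<subseteq> B3"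
      "\<theta> 1 ` V \<subseteq> C2" "\<theta> 1 ` V \<subseteq> C3"
    by (auto simp: V_def)
  have "continuous_map X X (\<eta> 1)" "continuous_map X X (\<theta> 1)"
    using G by (auto intro: homeomorphic_imp_continuous_map homeomorphic_map_mem)
  then have "openin X V"
    unfolding V_def using 1 2 3 by (intro openin_Int openin_continuous_map_preimage) auto
  moreover have "x \<in> V"
    using 1 2 3 x by (simp add: V_def)
  moreover have "V \<inter> \<eta> 1 ` V = {}" "V \<inter> \<theta> 1 ` V = {}" "\<eta> 1 ` V \<inter> \<theta> 1 ` V = {}"
    using sub 1(5) 2(5) 3(5) by (meson disjnt_def disjnt_subset1 disjnt_subset2)+
  ultimately show ?thesis
    using that \<eta> \<theta> by blast
qed

section \<open>Factorization and perfectness of the commutator group\<close>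

lemma foldr_factorization:
  assumes "isotopically_factorizable X G"
    and "\<And>V. V \<in> \<U> \<Longrightarrow> openin X V" "topspace X \<subseteq> \<Union>\<U>" "f \<in> carrier P"
  shows "\<exists>fs. set fs \<subseteq> carrier P \<and> f = foldr (\<otimes>\<^bsub>P\<^esub>) fs \<one>\<^bsub>P\<^esub> \<and>
    (\<forall>g\<in>set fs. \<exists>V\<in>\<U>. fixes_outside V g)"
proof -
  have "\<Union>\<U> = topspace X"
    using assms(2,3) openin_subset by blast
  then obtain fs where fs: "set fs \<subseteq> carrier P" "\<forall>g\<in>set fs. \<exists>V\<in>\<U>. path_supp X g \<subseteq> V"
      "f = foldr (\<otimes>\<^bsub>P\<^esub>) fs \<one>\<^bsub>P\<^esub>"
    using assms(1,2,4) unfolding isotopically_factorizable_def Let_def by meson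
  then show ?thesis
    using path_supp_imp_fixes_outside by (intro exI[of _ fs]) blast
qed

lemma commutator_cls_in_derived_derived:
  assumes X: "paracompact_space X" and fact: "isotopically_factorizable X G"
    and nonfix: "non_fixing X (identity_component (homeo_subgroup_topology X G) M)"
    and f: "f \<in> carrier P" and g: "g \<in> carrier P"
  shows "cls f \<otimes>\<^bsub>Cov\<^esub> cls g \<otimes>\<^bsub>Cov\<^esub> inv\<^bsub>Cov\<^esub> cls f \<otimes>\<^bsub>Cov\<^esub> inv\<^bsub>Cov\<^esub> cls g
    \<in> derived Cov (derived Cov (carrier Cov))" (is "_ \<in> ?N")
proof -
  have N: "?N \<lhd> Cov"
    by (intro Cov.derived_is_normal Cov.derived_self_is_normal)
  have Hausdorff: "Hausdorff_space X"
    using X by (simp add: paracompact_space_def)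
  define displaced where "displaced V \<longleftrightarrow> (\<exists>\<eta>\<in>carrier P. \<exists>\<theta>\<in>carrier P.
    V \<inter> \<eta> 1 ` V = {} \<and> V \<inter> \<theta> 1 ` V = {} \<and> \<eta> 1 ` V \<inter> \<theta> 1 ` V = {})" for V
  \<comment> \<open>The factors of \<open>g\<close> will live in \<open>V\<close>. The closed
    \<open>K\<close> in between makes \<open>{W, topspace X - K}\<close> an open cover, and
    \<open>W\<close> is where \<open>commutator_displaced\<close> applies.\<close>
  define \<V> where "\<V> = {V. openin X V \<and> (\<exists>K W. closedin X K \<and> openin X W \<and> V \<subseteq> K \<and> K \<subseteq> W \<and> displaced W)}"
  have \<V>_open: "openin X V" if "V \<in> \<V>" for V
    using that by (simp add: \<V>_def)
  have \<V>_cover: "topspace X \<subseteq> \<Union>\<V>"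
  proof
    fix x assume x: "x \<in> topspace X"
    obtain W where W: "openin X W" "x \<in> W" "displaced W"
      using displaced_neighbourhood[OF Hausdorff nonfix x] unfolding displaced_def by metis
    then obtain V K where "openin X V" "closedin X K" "x \<in> V" "V \<subseteq> K" "K \<subseteq> W"
      using paracompact_imp_regular_space[OF X]
      unfolding neighbourhood_base_of_closedin[symmetric] neighbourhood_base_of by meson
    then show "x \<in> \<Union>\<V>"
      using W unfolding \<V>_def by blast
  qed
  obtain gs where gs: "set gs \<subseteq> carrier P" "g = foldr (\<otimes>\<^bsub>P\<^esub>) gs \<one>\<^bsub>P\<^esub>"
      "\<And>g. g \<in> set gs \<Longrightarrow> \<exists>V\<in>\<V>. fixes_outside V g"
    using foldr_factorization[OF fact \<V>_open \<V>_cover g] by metis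
  have comm: "cls f \<otimes>\<^bsub>Cov\<^esub> cls g' \<otimes>\<^bsub>Cov\<^esub> inv\<^bsub>Cov\<^esub> cls f \<otimes>\<^bsub>Cov\<^esub> inv\<^bsub>Cov\<^esub> cls g' \<in> ?N"
    if g': "g' \<in> set gs" for g'
  proof -
    have g'P: "g' \<in> carrier P"
      using gs(1) g' by blast
    obtain V K W where V: "fixes_outside V g'" "V \<subseteq> K" "closedin X K"
      and W: "K \<subseteq> W" "openin X W" "displaced W"
      using gs(3)[OF g'] unfolding \<V>_def by blast
    have W_open: "openin X V" if "V \<in> {W, topspace X - K}" for V
      using that V(3) W(2) by auto
    have W_cover: "topspace X \<subseteq> \<Union>{W, topspace X - K}"
      using W(1) by blast
    \<comment> \<open>This factorization of \<open>f\<close> depends on \<open>g'\<close>, since the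
      cover is built from the \<open>K\<close> and \<open>W\<close> belonging to
      \<open>g'\<close>.\<close>
    obtain fs where fs: "set fs \<subseteq> carrier P" "f = foldr (\<otimes>\<^bsub>P\<^esub>) fs \<one>\<^bsub>P\<^esub>"
        "\<And>f'. f' \<in> set fs \<Longrightarrow> \<exists>V\<in>{W, topspace X - K}. fixes_outside V f'"
      using foldr_factorization[OF fact W_open W_cover f] by metis
    show ?thesis
      unfolding fs(2)
    proof (rule commutator_cls_foldr_in_normal[OF N fs(1)])
      show "cls g' \<in> carrier Cov"
        using g'P by simp
      fix f' assume f': "f' \<in> set fs"
      then have f'P: "f' \<in> carrier P"
        using fs(1) by blast
      consider "fixes_outside W f'" | "fixes_outside (topspace X - K) f'"
        using fs(3)[OF f'] by blast
      then show "cls f' \<otimes>\<^bsub>Cov\<^esub> cls g' \<otimes>\<^bsub>Cov\<^esub> inv\<^bsub>Cov\<^esub> cls f' \<otimes>\<^bsub>Cov\<^esub> inv\<^bsub>Cov\<^esub> cls g' \<in> ?N"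
      proof cases
        case 1
        have "fixes_outside W g'"
          using V(1,2) W(1) fixes_outside_mono by blast
        moreover obtain \<eta> \<theta> where "\<eta> \<in> carrier P" "\<theta> \<in> carrier P"
            "W \<inter> \<eta> 1 ` W = {}" "W \<inter> \<theta> 1 ` W = {}" "\<eta> 1 ` W \<inter> \<theta> 1 ` W = {}"
          using W(3) unfolding displaced_def by metis
        ultimately show ?thesis
          by (rule commutator_displaced[OF f'P 1 g'P])
      next
        case 2
        have "(topspace X - K) \<inter> V = {}"
          using V(2) by blast
        then have "cls f' \<otimes>\<^bsub>Cov\<^esub> cls g' = cls g' \<otimes>\<^bsub>Cov\<^esub> cls f'"
          by (rule cls_commute_if_disjoint[OF f'P 2 g'P V(1)])
        then have "cls f' \<otimes>\<^bsub>Cov\<^esub> cls g' \<otimes>\<^bsub>Cov\<^esub> inv\<^bsub>Cov\<^esub> cls f' \<otimes>\<^bsub>Cov\<^esub> inv\<^bsub>Cov\<^esub> cls g' = \<one>\<^bsub>Cov\<^esub>"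
          using f'P g'P by (intro Cov.commutator_eq_one) auto
        then show ?thesis
          using subgroup.one_closed[OF Cov.normal_invE(1)[OF N]] by simp
      qed
    qed
  qed
  \<comment> \<open>Products are expanded in the left entry only, so the entries are swapped to
    multiply up the factors of \<open>g\<close>, and swapped back at the end.\<close>
  have "cls g' \<otimes>\<^bsub>Cov\<^esub> cls f \<otimes>\<^bsub>Cov\<^esub> inv\<^bsub>Cov\<^esub> cls g' \<otimes>\<^bsub>Cov\<^esub> inv\<^bsub>Cov\<^esub> cls f \<in> ?N"
    if g': "g' \<in> set gs" for g'
  proof (rule Cov.commutator_swap_in_normal[OF N _ _ comm[OF g']])
    show "cls f \<in> carrier Cov" "cls g' \<in> carrier Cov"
      using f g' gs(1) by auto
  qed
  then have "cls g \<otimes>\<^bsub>Cov\<^esub> cls f \<otimes>\<^bsub>Cov\<^esub> inv\<^bsub>Cov\<^esub> cls g \<otimes>\<^bsub>Cov\<^esub> inv\<^bsub>Cov\<^esub> cls f \<in> ?N"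
    unfolding gs(2) by (intro commutator_cls_foldr_in_normal[OF N gs(1) cls.hom_closed[OF f]])
  then show ?thesis
    by (rule Cov.commutator_swap_in_normal[OF N cls.hom_closed[OF g] cls.hom_closed[OF f]])
qed

lemma derived_derived_universal_covering_group:
  assumes "paracompact_space X" and "isotopically_factorizable X G"
    and "non_fixing X (identity_component (homeo_subgroup_topology X G) M)"
  shows "derived Cov (derived Cov (carrier Cov)) = derived Cov (carrier Cov)" (is "?N = ?D")
proof
  have sub: "?D \<subseteq> carrier Cov"
    by (rule Cov.derived_in_carrier) simp
  then show "?N \<subseteq> ?D"
    by (rule Cov.mono_derived)
  \<comment> \<open>Every element of the covering group is the class of a path, so the preceding
    lemma covers all generators of \<open>?D\<close>.\<close>
  have "derived_set Cov (carrier Cov) \<subseteq> ?N"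
    using commutator_cls_in_derived_derived[OF assms]
    by (auto simp: carrier_universal_covering_group)
  then show "?D \<subseteq> ?N"
    unfolding derived_def[of Cov "carrier Cov"]
    using Cov.generate_subgroup_incl[OF _ Cov.derived_is_subgroup[OF sub]] by (simp add: derived_def)
qed

end

theorem theorem1p4:
  fixes X :: "'a topology" and G :: "('a \<Rightarrow> 'a) set"
  defines "G_tilde \<equiv>
    universal_covering_group (homeo_subgroup_topology X G) (homeo_subgroup X G)"
  assumes "paracompact_space X"
    and "subgroup G (homeo_group X)"
    and "topological_group (homeo_subgroup_topology X G) (homeo_subgroup X G)"
    and "isotopically_factorizable X G"
    and "non_fixing X (identity_component (homeo_subgroup_topology X G) (homeo_subgroup X G))"
  shows "derived G_tilde (derived G_tilde (carrier G_tilde)) = derived G_tilde (carrier G_tilde)"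
proof -
  \<comment> \<open>The group axioms that the locale asks for are part of
    \<open>topological_group\<close>.\<close>
  interpret homeo_top_group X G
    using assms(3,4)
    by (simp add: homeo_top_group_def top_group_def top_group_axioms_def homeo_top_group_axioms_def
        topological_group_def)
  show ?thesis
    unfolding G_tilde_def by (rule derived_derived_universal_covering_group[OF assms(2,5,6)])
qed

end
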